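(* Let $n\geq 2$, $p>0$, and let $f\in C_0(\mathbb{Z}^n)$ be nonnegative with $\|f\|_p=1$. For $i=1,\dots,n$ define $f_i:\mathbb{Z}^{n-1}\to\mathbb{R}$ by $$f_i(z_1,\dots,\widehat{z_i},\dots,z_n)=\max_{z_i\in\mathbb{Z}}f(z_1,\dots,z_i,\dots,z_n).$$ Then $$\left(\frac1n+\frac1p-1\right)\sum_{z\in\mathbb{Z}^n}f(z)^p\log f(z)^p\leq\frac1n\sum_{i=1}^n\log\|f_i\|_1.$$ Moreover, equality holds if and only if $f=|A|^{-\frac1p}\cdot\chi_A$ for some nonempty finite subset $A\subset\mathbb{Z}^n$ with $A=\prod_{i=1}^n\pi_i(A)$.
   Context: $C_0(\mathbb{Z}^m)$ denotes the space of real-valued functions on $\mathbb{Z}^m$ with finite support. For $q>0$ and $g\in C_0(\mathbb{Z}^m)$, $\|g\|_q:=\left(\sum_{z\in\mathbb{Z}^m}|g(z)|^q\right)^{1/q}$; here $\|f\|_p$ is taken on $\mathbb{Z}^n$ and $\|f_i\|_1$ on $\mathbb{Z}^{n-1}$. The notation $\widehat{z_i}$ means that $z_i$ is omitted. The convention $0\log 0=0$ is used. $\pi_i:\mathbb{Z}^n\to\mathbb{Z}$ is the projection $(z_1,\dots,z_n)\mapsto z_i$; $\chi_A$ is the indicator function of $A$ and $|A|$ its cardinality. *)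

theory Defs
  imports "HOL-Analysis.Infinite_Sum" "HOL-Library.FuncSet" "HOL-Library.Indicator_Function"
begin

text \<open>A point of the lattice is a tuple indexed by \<open>1, \<dots>, m\<close>, made unique as a function on
  \<^typ>\<open>nat\<close> by extensionality. A function on the lattice is a function on \<^typ>\<open>nat \<Rightarrow> int\<close>
  whose values off the lattice are irrelevant.\<close>

definition int_lattice :: "nat \<Rightarrow> (nat \<Rightarrow> int) set" where
  "int_lattice m = {1..m} \<rightarrow>\<^sub>E UNIV"

definition C0 :: "nat \<Rightarrow> ((nat \<Rightarrow> int) \<Rightarrow> real) set" where
  "C0 m = {g. finite {z \<in> int_lattice m. g z \<noteq> 0}}"

definition lq_norm :: "nat \<Rightarrow> real \<Rightarrow> ((nat \<Rightarrow> int) \<Rightarrow> real) \<Rightarrow> real" where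
  "lq_norm m q g = (\<Sum>\<^sub>\<infinity>z\<in>int_lattice m. \<bar>g z\<bar> powr q) powr (1 / q)"

text \<open>\<open>insert_coord i t\<close> sends \<open>(z\<^sub>1, \<dots>, z\<^sub>n\<^sub>-\<^sub>1)\<close> to \<open>(z\<^sub>1, \<dots>, z\<^sub>i\<^sub>-\<^sub>1, t, z\<^sub>i, \<dots>, z\<^sub>n\<^sub>-\<^sub>1)\<close>;
  for \<open>1 \<le> i \<le> n\<close> it maps \<open>int_lattice (n - 1)\<close> into \<open>int_lattice n\<close>.\<close>

definition insert_coord :: "nat \<Rightarrow> int \<Rightarrow> (nat \<Rightarrow> int) \<Rightarrow> (nat \<Rightarrow> int)" where
  "insert_coord i t z = (\<lambda>j. if j < i then z j else if j = i then t else z (j - 1))"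

text \<open>The function \<open>f\<^sub>i\<close>. If \<open>f \<in> C0 n\<close> and \<open>1 \<le> i \<le> n\<close>, then the set of values is finite at every
  point of \<open>int_lattice (n - 1)\<close>, so that \<^const>\<open>Max\<close> is the actual maximum.\<close>

definition coord_max :: "nat \<Rightarrow> ((nat \<Rightarrow> int) \<Rightarrow> real) \<Rightarrow> ((nat \<Rightarrow> int) \<Rightarrow> real)" where
  "coord_max i f z = Max (range (\<lambda>t. f (insert_coord i t z)))"

end

theory Submission imports Defs begin

text \<open>Regard \<open>\<mu> = f\<^sup>p\<close> as the law of a random point \<open>X\<close> with entropy \<open>H(X)\<close>, and let \<open>X\<^sub>-\<^sub>i\<close> be \<open>X\<close>
  without its \<open>i\<close>-th coordinate. Gibbs' inequality, applied to the law proportional to \<open>f\<^sub>i\<close>,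
  gives \<open>ln \<parallel>f\<^sub>i\<parallel>\<^sub>1 \<ge> H(X\<^sub>-\<^sub>i) + E (ln f) = H(X\<^sub>-\<^sub>i) - H(X) / p\<close>, and Han's inequality
  \<open>\<Sum>\<^sub>i H(X\<^sub>-\<^sub>i) \<ge> (n - 1) H(X)\<close> finishes the estimate. Equality in Han's inequality makes every
  coordinate independent of the others, and equality in Gibbs' inequality makes \<open>f\<close> proportional to
  the law of \<open>X\<^sub>-\<^sub>i\<close> on the support, hence constant there in each coordinate direction. So the support
  is a box and \<open>f\<close> is constant on it.\<close>

section \<open>Gibbs' inequality and sums over a finite product\<close>

text \<open>Summing ln x \<le> x - 1 at x = q / \<mu> with weights \<mu> gives the bound, and q may
  have smaller total mass than \<mu>. Equality makes every pointwise defect vanish, and ln x = x - 1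
  only at x = 1. Where \<mu> is 0 the defect is q itself, so q vanishes there too.\<close>

lemma gibbs_inequality:
  fixes \<mu> q :: "'a \<Rightarrow> real"
  assumes fin: "finite B"
    and \<mu>_nonneg: "\<And>z. z \<in> B \<Longrightarrow> \<mu> z \<ge> 0"
    and q_nonneg: "\<And>z. z \<in> B \<Longrightarrow> q z \<ge> 0"
    and sums: "sum q B \<le> sum \<mu> B"
    and pos: "\<And>z. z \<in> B \<Longrightarrow> \<mu> z > 0 \<Longrightarrow> q z > 0"
  shows "(\<Sum>z\<in>B. \<mu> z * ln (q z)) \<le> (\<Sum>z\<in>B. \<mu> z * ln (\<mu> z))"
    and "(\<Sum>z\<in>B. \<mu> z * ln (q z)) = (\<Sum>z\<in>B. \<mu> z * ln (\<mu> z)) \<Longrightarrow> z \<in> B \<Longrightarrow> q z = \<mu> z"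
proof -
  \<comment> \<open>The pointwise defect; its sum is the mass difference minus the difference of the
    two sides of the claim.\<close>
  define d where "d z = q z - \<mu> z - (\<mu> z * ln (q z) - \<mu> z * ln (\<mu> z))" for z
  have d_eq: "d z = \<mu> z * (q z / \<mu> z - 1 - ln (q z / \<mu> z))" if "z \<in> B" "\<mu> z > 0" for z
    using that pos[OF that] by (simp add: d_def ln_div field_simps)
  have d_nonneg: "d z \<ge> 0" if z: "z \<in> B" for z
  proof (cases "\<mu> z > 0")
    case True
    then show ?thesis
      using d_eq[OF z True] ln_le_minus_one[of "q z / \<mu> z"] pos[OF z True] by simp
  next
    case False
    then have "\<mu> z = 0" using \<mu>_nonneg[OF z] by simp
    then show ?thesis using q_nonneg[OF z] by (simp add: d_def)
  qed
  have sum_d: "sum d B = sum q B - sum \<mu> B - ((\<Sum>z\<in>B. \<mu> z * ln (q z)) - (\<Sum>z\<in>B. \<mu> z * ln (\<mu> z)))"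
    by (simp add: d_def sum_subtractf)
  have "sum d B \<ge> 0" using d_nonneg by (rule sum_nonneg)
  then show "(\<Sum>z\<in>B. \<mu> z * ln (q z)) \<le> (\<Sum>z\<in>B. \<mu> z * ln (\<mu> z))"
    using sum_d sums by linarith
  assume eq: "(\<Sum>z\<in>B. \<mu> z * ln (q z)) = (\<Sum>z\<in>B. \<mu> z * ln (\<mu> z))" and z: "z \<in> B"
  have "sum d B = 0" using sum_d sums eq \<open>sum d B \<ge> 0\<close> by linarith
  then have d0: "d z = 0" using sum_nonneg_eq_0_iff[OF fin, of d] d_nonneg z by blast
  show "q z = \<mu> z"
  proof (cases "\<mu> z > 0")
    case True
    then have "ln (q z / \<mu> z) = q z / \<mu> z - 1" using d_eq[OF z True] d0 by simp
    then have "q z / \<mu> z = 1" by (intro ln_eq_minus_one) (use pos[OF z True] True in simp_all)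
    then show ?thesis using True by simp
  next
    case False
    then have "\<mu> z = 0" using \<mu>_nonneg[OF z] by simp
    then show ?thesis using d0 by (simp add: d_def)
  qed
qed

lemma sum_PiE_remove:
  assumes "i \<in> I"
  shows "sum g (Pi\<^sub>E I K) = (\<Sum>a\<in>Pi\<^sub>E (I - {i}) K. \<Sum>b\<in>K i. g (a(i := b)))"
proof -
  have I: "insert i (I - {i}) = I" using assms by auto
  have inj: "inj_on (\<lambda>(b, a). a(i := b)) (K i \<times> Pi\<^sub>E (I - {i}) K)"
    using inj_combinator[of i "I - {i}" K] by simp
  have "Pi\<^sub>E I K = (\<lambda>(b, a). a(i := b)) ` (K i \<times> Pi\<^sub>E (I - {i}) K)"
    using PiE_insert_eq[of i "I - {i}" K] I by simp
  then have "sum g (Pi\<^sub>E I K) = (\<Sum>(b, a)\<in>K i \<times> Pi\<^sub>E (I - {i}) K. g (a(i := b)))"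
    by (simp only: sum.reindex[OF inj]) (simp add: comp_def case_prod_unfold)
  also have "\<dots> = (\<Sum>b\<in>K i. \<Sum>a\<in>Pi\<^sub>E (I - {i}) K. g (a(i := b)))"
    by (simp add: sum.cartesian_product)
  also have "\<dots> = (\<Sum>a\<in>Pi\<^sub>E (I - {i}) K. \<Sum>b\<in>K i. g (a(i := b)))"
    by (rule sum.swap)
  finally show ?thesis .
qed

section \<open>Marginals and Han's inequality\<close>

locale product_distribution =
  fixes I :: "'i set" and K :: "'i \<Rightarrow> 'a set" and \<mu> :: "('i \<Rightarrow> 'a) \<Rightarrow> real"
  assumes finite_I: "finite I"
    and finite_K: "\<And>i. i \<in> I \<Longrightarrow> finite (K i)"
    and nonneg: "\<And>z. z \<in> Pi\<^sub>E I K \<Longrightarrow> \<mu> z \<ge> 0"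
    and sum_one: "sum \<mu> (Pi\<^sub>E I K) = 1"
begin

abbreviation box :: "('i \<Rightarrow> 'a) set" where "box \<equiv> Pi\<^sub>E I K"

text \<open>Only the coordinates of \<open>z\<close> in \<open>S\<close> are read, so the marginals
  on different index sets share one argument type and can be multiplied without restricting
  points.\<close>

definition marginal :: "'i set \<Rightarrow> ('i \<Rightarrow> 'a) \<Rightarrow> real" where
  "marginal S z = sum \<mu> {w \<in> box. \<forall>j\<in>S. w j = z j}"

text \<open>This is -H(X_S), written as an expectation over the full box, so that the entropies of
  different index sets combine term by term.\<close>

definition neg_entropy :: "'i set \<Rightarrow> real" where
  "neg_entropy S = (\<Sum>z\<in>box. \<mu> z * ln (marginal S z))"

lemma finite_box: "finite box"
  by (intro finite_PiE finite_I finite_K)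

lemma marginal_nonneg: "marginal S z \<ge> 0"
  unfolding marginal_def by (rule sum_nonneg) (use nonneg in auto)

lemma marginal_mono: "S \<subseteq> T \<Longrightarrow> marginal T z \<le> marginal S z"
  unfolding marginal_def by (rule sum_mono2) (use finite_box nonneg in auto)

lemma marginal_cong: "(\<And>j. j \<in> S \<Longrightarrow> w j = z j) \<Longrightarrow> marginal S w = marginal S z"
  unfolding marginal_def by (rule sum.cong) auto

lemma marginal_fun_upd: "i \<notin> S \<Longrightarrow> marginal S (z(i := b)) = marginal S z"
  by (rule marginal_cong) auto

lemma marginal_empty: "marginal {} z = 1"
  using sum_one by (simp add: marginal_def)

lemma marginal_full:
  assumes "z \<in> box"
  shows "marginal I z = \<mu> z"
proof -
  have "{w \<in> box. \<forall>j\<in>I. w j = z j} = {z}"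
    using assms by (auto intro: PiE_ext)
  then show ?thesis by (simp add: marginal_def)
qed

lemma marginal_pos:
  assumes "z \<in> box" "\<mu> z > 0" "S \<subseteq> I"
  shows "marginal S z > 0"
  using marginal_mono[OF assms(3), of z] marginal_full assms by simp

lemma marginal_split:
  assumes "i \<in> I" "i \<notin> S"
  shows "marginal S z = (\<Sum>b\<in>K i. marginal (insert i S) (z(i := b)))"
proof -
  have "sum \<mu> {w \<in> box. \<forall>j\<in>S. w j = z j}
      = (\<Sum>b\<in>K i. sum \<mu> {w \<in> {w \<in> box. \<forall>j\<in>S. w j = z j}. w i = b})"
    by (rule sum.group[symmetric]) (use assms finite_box finite_K in auto)
  also have "\<dots> = (\<Sum>b\<in>K i. marginal (insert i S) (z(i := b)))"
    unfolding marginal_def by (intro sum.cong refl) (use assms in auto)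
  finally show ?thesis by (simp add: marginal_def)
qed

lemma marginal_fibre:
  assumes "i \<in> I" "a \<in> Pi\<^sub>E (I - {i}) K"
  shows "marginal (I - {i}) a = (\<Sum>b\<in>K i. \<mu> (a(i := b)))"
proof -
  have "insert i (I - {i}) = I" using assms by auto
  moreover have "a(i := b) \<in> box" if "b \<in> K i" for b
    using assms that by (auto simp: PiE_iff extensional_def)
  ultimately show ?thesis
    using marginal_split[of i "I - {i}" a] assms by (simp add: marginal_full)
qed

lemma neg_entropy_empty: "neg_entropy {} = 0"
  by (simp add: neg_entropy_def marginal_empty)

lemma neg_entropy_full: "neg_entropy I = (\<Sum>z\<in>box. \<mu> z * ln (\<mu> z))"
  unfolding neg_entropy_def by (intro sum.cong refl) (simp add: marginal_full)

text \<open>Gibbs' inequality for the law that makes the coordinate \<open>i\<close> and the coordinates outside \<open>S\<close>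
  conditionally independent given those in \<open>S\<close>. Division by zero gives \<open>0\<close> where the marginal on \<open>S\<close>
  vanishes.\<close>

lemma neg_entropy_supermodular:
  assumes i: "i \<in> I" and S: "S \<subseteq> I - {i}"
  shows "neg_entropy (insert i S) - neg_entropy S \<le> neg_entropy I - neg_entropy (I - {i})"
    and "neg_entropy (insert i S) - neg_entropy S = neg_entropy I - neg_entropy (I - {i}) \<Longrightarrow>
      z \<in> box \<Longrightarrow> marginal (I - {i}) z * marginal (insert i S) z / marginal S z = \<mu> z"
proof -
  define q where "q z = marginal (I - {i}) z * marginal (insert i S) z / marginal S z" for z
  have q_nonneg: "q z \<ge> 0" for z
    by (simp add: q_def marginal_nonneg)
  have q_pos: "q z > 0" if "z \<in> box" "\<mu> z > 0" for z
    using i S that unfolding q_def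
    by (intro divide_pos_pos mult_pos_pos marginal_pos) auto
  have "sum q box = (\<Sum>a\<in>Pi\<^sub>E (I - {i}) K. \<Sum>b\<in>K i. q (a(i := b)))"
    by (rule sum_PiE_remove[OF i])
  also have "\<dots> \<le> (\<Sum>a\<in>Pi\<^sub>E (I - {i}) K. \<Sum>b\<in>K i. \<mu> (a(i := b)))"
  proof (rule sum_mono)
    fix a assume a: "a \<in> Pi\<^sub>E (I - {i}) K"
    \<comment> \<open>Since i is not in S, the new coordinate \<open>b\<close> enters through one
      factor only, and the fibre sum of that factor collapses by
      \<open>marginal_split\<close>.\<close>
    have "q (a(i := b)) = marginal (I - {i}) a / marginal S a * marginal (insert i S) (a(i := b))" for b
    proof -
      have "marginal (I - {i}) (a(i := b)) = marginal (I - {i}) a" "marginal S (a(i := b)) = marginal S a"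
        using S by (auto intro: marginal_fun_upd)
      then show ?thesis by (simp add: q_def)
    qed
    then have "(\<Sum>b\<in>K i. q (a(i := b)))
        = marginal (I - {i}) a / marginal S a * (\<Sum>b\<in>K i. marginal (insert i S) (a(i := b)))"
      by (simp only: sum_distrib_left)
    also have "\<dots> = marginal (I - {i}) a / marginal S a * marginal S a"
      by (subst marginal_split[of i S a]) (use i S in auto)
    \<comment> \<open>Equality unless \<open>marginal S a\<close> is 0, when the left side is
      0.\<close>
    also have "\<dots> \<le> marginal (I - {i}) a"
      by (simp add: marginal_nonneg)
    finally show "(\<Sum>b\<in>K i. q (a(i := b))) \<le> (\<Sum>b\<in>K i. \<mu> (a(i := b)))"
      using marginal_fibre[OF i a] by simp
  qed
  also have "\<dots> = sum \<mu> box" by (rule sum_PiE_remove[OF i, symmetric])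
  finally have sum_q: "sum q box \<le> sum \<mu> box" .
  \<comment> \<open>The logarithm splits where \<mu> is positive, because all three marginals are
    positive there; elsewhere the weight is 0.\<close>
  have "\<mu> z * ln (q z) = \<mu> z * ln (marginal (I - {i}) z) + \<mu> z * ln (marginal (insert i S) z)
      - \<mu> z * ln (marginal S z)" if z: "z \<in> box" for z
  proof (cases "\<mu> z > 0")
    case True
    have "marginal T z > 0" if "T \<subseteq> I" for T using marginal_pos z True that by blast
    from this[of "I - {i}"] this[of "insert i S"] this[of S] show ?thesis
      using i S by (auto simp: q_def ln_div ln_mult subset_Diff_insert algebra_simps)
  qed (use nonneg[OF z] in simp)
  then have *: "(\<Sum>z\<in>box. \<mu> z * ln (q z))
      = neg_entropy (I - {i}) + neg_entropy (insert i S) - neg_entropy S"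
    by (simp add: neg_entropy_def sum.distrib sum_subtractf)
  note gibbs = gibbs_inequality[OF finite_box nonneg q_nonneg sum_q q_pos]
  show "neg_entropy (insert i S) - neg_entropy S \<le> neg_entropy I - neg_entropy (I - {i})"
    using gibbs(1) * neg_entropy_full by simp
  show "marginal (I - {i}) z * marginal (insert i S) z / marginal S z = \<mu> z"
    if "neg_entropy (insert i S) - neg_entropy S = neg_entropy I - neg_entropy (I - {i})" "z \<in> box"
    using gibbs(2)[of z] * neg_entropy_full that by (simp add: q_def)
qed

text \<open>The coordinates of R are added one at a time. By supermodularity each increment is at
  most the one obtained when all other coordinates are already present.\<close>

lemma neg_entropy_chain:
  assumes "S \<subseteq> I" "R \<subseteq> I" "S \<inter> R = {}"
  shows "neg_entropy (S \<union> R) - neg_entropy S \<le> (\<Sum>i\<in>R. neg_entropy I - neg_entropy (I - {i}))"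
proof -
  have "finite R" using assms finite_I finite_subset by blast
  then show ?thesis using assms
  proof (induction R)
    case (insert i R)
    then have "i \<in> I" "S \<union> R \<subseteq> I - {i}" by auto
    from neg_entropy_supermodular(1)[OF this] insert show ?case by simp
  qed simp
qed

text \<open>The bound is the chain from the empty set to I. For equality the chain is started at
  {i}: this forces the remaining increment, from the empty set to {i}, to be maximal as well, that
  is H(X_i) = H(X) - H(X_-i). The equality case of \<open>neg_entropy_supermodular\<close> for S =
  {} turns this into independence.\<close>

lemma han_inequality:
  shows "neg_entropy I \<le> (\<Sum>i\<in>I. neg_entropy I - neg_entropy (I - {i}))"
    and "neg_entropy I = (\<Sum>i\<in>I. neg_entropy I - neg_entropy (I - {i})) \<Longrightarrow> i \<in> I \<Longrightarrow> z \<in> box \<Longrightarrow>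
      \<mu> z = marginal (I - {i}) z * marginal {i} z"
proof -
  show "neg_entropy I \<le> (\<Sum>i\<in>I. neg_entropy I - neg_entropy (I - {i}))"
    using neg_entropy_chain[of "{}" I] by (simp add: neg_entropy_empty)
  assume eq: "neg_entropy I = (\<Sum>i\<in>I. neg_entropy I - neg_entropy (I - {i}))"
    and i: "i \<in> I" and z: "z \<in> box"
  have "neg_entropy I - neg_entropy {i} \<le> (\<Sum>j\<in>I - {i}. neg_entropy I - neg_entropy (I - {j}))"
    using neg_entropy_chain[of "{i}" "I - {i}"] i by (simp add: insert_absorb)
  moreover have "neg_entropy I = neg_entropy I - neg_entropy (I - {i})
      + (\<Sum>j\<in>I - {i}. neg_entropy I - neg_entropy (I - {j}))"
    using eq sum.remove[OF finite_I i] by metis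
  moreover have "neg_entropy {i} \<le> neg_entropy I - neg_entropy (I - {i})"
    using neg_entropy_supermodular(1)[OF i, of "{}"] by (simp add: neg_entropy_empty)
  ultimately have "neg_entropy {i} - neg_entropy {} = neg_entropy I - neg_entropy (I - {i})"
    by (simp add: neg_entropy_empty)
  then show "\<mu> z = marginal (I - {i}) z * marginal {i} z"
    using neg_entropy_supermodular(2)[OF i, of "{}" z] z by (simp add: marginal_empty)
qed

section \<open>Entropy bound from a majorant on fibres\<close>

text \<open>The conditional law of X_i given the other coordinates, multiplied by f / F, is compared
  with \<mu> by Gibbs' inequality. As f \<le> h on each fibre, its mass over the fibre of
  \<open>a\<close> is at most h a / F, and these bounds add up to 1.\<close>

lemma fibre_bound_inequality:
  assumes i: "i \<in> I"
    and f_pos: "\<And>z. z \<in> box \<Longrightarrow> \<mu> z > 0 \<Longrightarrow> f z > 0"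
    and h_nonneg: "\<And>a. a \<in> Pi\<^sub>E (I - {i}) K \<Longrightarrow> h a \<ge> 0"
    and f_le: "\<And>a b. a \<in> Pi\<^sub>E (I - {i}) K \<Longrightarrow> b \<in> K i \<Longrightarrow> 0 \<le> f (a(i := b)) \<and> f (a(i := b)) \<le> h a"
    and F: "sum h (Pi\<^sub>E (I - {i}) K) = F" "F > 0"
  shows "(\<Sum>z\<in>box. \<mu> z * ln (f z)) - neg_entropy (I - {i}) \<le> ln F"
    and "(\<Sum>z\<in>box. \<mu> z * ln (f z)) - neg_entropy (I - {i}) = ln F \<Longrightarrow> z \<in> box \<Longrightarrow> \<mu> z > 0 \<Longrightarrow>
      f z = F * marginal (I - {i}) z"
proof -
  define q where "q z = \<mu> z * f z / (F * marginal (I - {i}) z)" for z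
  have upd: "a(i := b) \<in> box" if "a \<in> Pi\<^sub>E (I - {i}) K" "b \<in> K i" for a b
    using i that by (auto simp: PiE_iff extensional_def)
  have m_pos: "marginal (I - {i}) z > 0" if "z \<in> box" "\<mu> z > 0" for z
    by (rule marginal_pos) (use that in auto)
  have q_pos: "q z > 0" if "z \<in> box" "\<mu> z > 0" for z
    using that m_pos f_pos F by (simp add: q_def)
  have q_nonneg: "q z \<ge> 0" if z: "z \<in> box" for z
    using q_pos[OF z] nonneg[OF z] by (cases "\<mu> z > 0") (auto simp: q_def)
  have "sum q box = (\<Sum>a\<in>Pi\<^sub>E (I - {i}) K. \<Sum>b\<in>K i. q (a(i := b)))"
    by (rule sum_PiE_remove[OF i])
  also have "\<dots> \<le> (\<Sum>a\<in>Pi\<^sub>E (I - {i}) K. h a / F)"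
  proof (rule sum_mono)
    fix a assume a: "a \<in> Pi\<^sub>E (I - {i}) K"
    let ?m = "marginal (I - {i}) a"
    have m: "marginal (I - {i}) (a(i := b)) = ?m" for b by (simp add: marginal_fun_upd)
    have "(\<Sum>b\<in>K i. q (a(i := b))) \<le> (\<Sum>b\<in>K i. \<mu> (a(i := b)) * h a / (F * ?m))"
      unfolding q_def m using f_le[OF a] nonneg upd[OF a] F marginal_nonneg
      by (intro sum_mono divide_right_mono mult_left_mono) auto
    also have "\<dots> = ?m * h a / (F * ?m)"
      by (simp add: marginal_fibre[OF i a] sum_distrib_right sum_divide_distrib)
    \<comment> \<open>Equality where the marginal is positive; division by zero gives 0
      otherwise.\<close>
    also have "\<dots> \<le> h a / F"
      using h_nonneg[OF a] F by simp
    finally show "(\<Sum>b\<in>K i. q (a(i := b))) \<le> h a / F" .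
  qed
  also have "\<dots> = sum \<mu> box" using F by (simp add: sum_divide_distrib[symmetric] sum_one)
  finally have sum_q: "sum q box \<le> sum \<mu> box" .
  have "\<mu> z * ln (q z) = \<mu> z * ln (\<mu> z) + \<mu> z * ln (f z)
      - \<mu> z * ln F - \<mu> z * ln (marginal (I - {i}) z)" if z: "z \<in> box" for z
  proof (cases "\<mu> z > 0")
    case True
    then show ?thesis
      using m_pos[OF z True] f_pos[OF z True] F by (simp add: q_def ln_div ln_mult algebra_simps)
  qed (use nonneg[OF z] in simp)
  then have *: "(\<Sum>z\<in>box. \<mu> z * ln (q z)) = (\<Sum>z\<in>box. \<mu> z * ln (\<mu> z))
      + (\<Sum>z\<in>box. \<mu> z * ln (f z)) - ln F - neg_entropy (I - {i})"
    by (simp add: neg_entropy_def sum.distrib sum_subtractf sum_distrib_right[symmetric] sum_one)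
  note gibbs = gibbs_inequality[OF finite_box nonneg q_nonneg sum_q q_pos]
  show "(\<Sum>z\<in>box. \<mu> z * ln (f z)) - neg_entropy (I - {i}) \<le> ln F"
    using gibbs(1) * by simp
  assume eq: "(\<Sum>z\<in>box. \<mu> z * ln (f z)) - neg_entropy (I - {i}) = ln F"
    and z: "z \<in> box" "\<mu> z > 0"
  \<comment> \<open>The factor \<mu> z > 0 then cancels, which is why \<open>f\<close> is determined
    on the support only.\<close>
  have "q z = \<mu> z" using gibbs(2)[of z] * eq z by simp
  then show "f z = F * marginal (I - {i}) z"
    using z m_pos[OF z] F by (simp add: q_def field_simps)
qed

end

section \<open>Densities on the lattice\<close>

text \<open>The same maximum as in \<open>coord_max\<close>, but without renumbering: the point
  keeps the index i, whose value is overwritten. It is thus a function on the box with the factor i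
  removed, as in \<open>fibre_bound_inequality\<close>.\<close>

definition fibre_max :: "'i \<Rightarrow> (('i \<Rightarrow> 'a) \<Rightarrow> real) \<Rightarrow> ('i \<Rightarrow> 'a) \<Rightarrow> real" where
  "fibre_max i f a = Max (range (\<lambda>t. f (a(i := t))))"

lemma coord_max_eq_fibre_max: "coord_max i f z = fibre_max i f (insert_coord i undefined z)"
proof -
  have "(insert_coord i undefined z)(i := t) = insert_coord i t z" for t
    by (auto simp: insert_coord_def)
  then show ?thesis by (simp add: coord_max_def fibre_max_def)
qed

text \<open>Inserting \<open>undefined\<close> at i gives exactly the extensional functions on the
  indices other than i. The inverse deletes slot i and moves the later entries down by one.\<close>

lemma bij_betw_insert_coord:
  assumes "i \<in> {1..n}"
  shows "bij_betw (insert_coord i undefined) (int_lattice (n - 1)) (Pi\<^sub>E ({1..n} - {i}) (\<lambda>_. UNIV))"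
proof (rule bij_betw_byWitness[where f' = "\<lambda>a j. if j < i then a j else a (Suc j)"])
  show "\<forall>z\<in>int_lattice (n - 1).
      (\<lambda>j. if j < i then insert_coord i undefined z j else insert_coord i undefined z (Suc j)) = z"
    by (intro ballI ext) (simp add: insert_coord_def)
  show "\<forall>a\<in>Pi\<^sub>E ({1..n} - {i}) (\<lambda>_. UNIV).
      insert_coord i undefined (\<lambda>j. if j < i then a j else a (Suc j)) = a"
  proof (intro ballI ext)
    fix a :: "nat \<Rightarrow> int" and j
    assume "a \<in> Pi\<^sub>E ({1..n} - {i}) (\<lambda>_. UNIV)"
    then have "a i = undefined" by (simp add: PiE_iff extensional_def)
    then show "insert_coord i undefined (\<lambda>j. if j < i then a j else a (Suc j)) j = a j"
      by (cases j) (auto simp: insert_coord_def)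
  qed
  show "insert_coord i undefined ` int_lattice (n - 1) \<subseteq> Pi\<^sub>E ({1..n} - {i}) (\<lambda>_. UNIV)"
  proof (rule image_subsetI)
    fix z assume "z \<in> int_lattice (n - 1)"
    then have z: "z j = undefined" if "j \<notin> {1..n - 1}" for j
      using that by (simp add: int_lattice_def PiE_iff extensional_def)
    have "insert_coord i undefined z j = undefined" if "j \<notin> {1..n} - {i}" for j
    proof -
      \<comment> \<open>Below i the indices agree, above i they are shifted by one; in both cases an
        index outside the target range comes from one outside {1..n-1}.\<close>
      have "j < i \<Longrightarrow> j \<notin> {1..n - 1}" "j > i \<Longrightarrow> j - 1 \<notin> {1..n - 1}" using assms that by auto
      then show ?thesis using z unfolding insert_coord_def by auto
    qed
    then show "insert_coord i undefined z \<in> Pi\<^sub>E ({1..n} - {i}) (\<lambda>_. UNIV)"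
      by (simp add: PiE_iff extensional_def)
  qed
  show "(\<lambda>a j. if j < i then a j else a (Suc j)) ` Pi\<^sub>E ({1..n} - {i}) (\<lambda>_. UNIV) \<subseteq> int_lattice (n - 1)"
  proof (rule image_subsetI)
    fix a :: "nat \<Rightarrow> int"
    assume "a \<in> Pi\<^sub>E ({1..n} - {i}) (\<lambda>_. UNIV)"
    then have a: "a j = undefined" if "j \<notin> {1..n}" for j
      using that by (auto simp: PiE_iff extensional_def)
    have "(if j < i then a j else a (Suc j)) = undefined" if "j \<notin> {1..n - 1}" for j
    proof -
      have "j < i \<Longrightarrow> j \<notin> {1..n}" "\<not> j < i \<Longrightarrow> Suc j \<notin> {1..n}" using assms that by auto
      then show ?thesis using a[of j] a[of "Suc j"] by simp
    qed
    then show "(\<lambda>j. if j < i then a j else a (Suc j)) \<in> int_lattice (n - 1)"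
      unfolding int_lattice_def PiE_iff extensional_def by blast
  qed
qed

declare One_nat_def [simp del]

locale lattice_density =
  fixes n :: nat and p :: real and f :: "(nat \<Rightarrow> int) \<Rightarrow> real"
  assumes p_pos: "p > 0"
    and f_C0: "f \<in> C0 n"
    and f_nonneg: "\<And>z. z \<in> int_lattice n \<Longrightarrow> f z \<ge> 0"
    and f_norm: "lq_norm n p f = 1"
begin

definition supp :: "(nat \<Rightarrow> int) set" where
  "supp = {z \<in> int_lattice n. f z \<noteq> 0}"

text \<open>The projections of the support span the smallest box containing it. On the lattice
  \<open>f\<close> vanishes off this box, so the lattice sums become finite; in the equality case
  the support will fill the box.\<close>

definition K :: "nat \<Rightarrow> int set" where
  "K i = (\<lambda>z. z i) ` supp"

definition \<mu> :: "(nat \<Rightarrow> int) \<Rightarrow> real" where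
  "\<mu> z = f z powr p"

lemma finite_supp: "finite supp"
  using f_C0 by (simp add: supp_def C0_def)

lemma finite_proj: "finite (K i)"
  by (simp add: K_def finite_supp)

lemma box_subset: "Pi\<^sub>E {1..n} K \<subseteq> int_lattice n"
  unfolding int_lattice_def by (rule PiE_mono) auto

lemma supp_subset: "supp \<subseteq> Pi\<^sub>E {1..n} K"
proof
  fix z assume z: "z \<in> supp"
  then have "z \<in> extensional {1..n}" by (simp add: supp_def int_lattice_def PiE_iff)
  then show "z \<in> Pi\<^sub>E {1..n} K" using z by (simp add: PiE_iff K_def)
qed

lemma f_eq_0: "z \<in> int_lattice n \<Longrightarrow> z \<notin> Pi\<^sub>E {1..n} K \<Longrightarrow> f z = 0"
  using supp_subset unfolding supp_def by blast

lemma f_pos_iff: "z \<in> int_lattice n \<Longrightarrow> f z > 0 \<longleftrightarrow> z \<in> supp"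
  using f_nonneg[of z] by (auto simp: supp_def)

lemma \<mu>_pos_iff: "z \<in> int_lattice n \<Longrightarrow> \<mu> z > 0 \<longleftrightarrow> z \<in> supp"
  by (simp add: supp_def \<mu>_def)

lemma infsum_lattice:
  assumes "\<And>z. z \<in> int_lattice n \<Longrightarrow> f z = 0 \<Longrightarrow> g z = 0"
  shows "infsum g (int_lattice n) = sum g (Pi\<^sub>E {1..n} K)"
proof -
  have "infsum g (int_lattice n) = infsum g (Pi\<^sub>E {1..n} K)"
    by (rule infsum_cong_neutral) (use assms f_eq_0 box_subset in auto)
  then show ?thesis by (simp add: finite_PiE finite_proj)
qed

sublocale product_distribution "{1..n}" K \<mu>
proof
  define s where "s = (\<Sum>\<^sub>\<infinity>z\<in>int_lattice n. \<bar>f z\<bar> powr p)"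
  have "s \<ge> 0" unfolding s_def by (rule infsum_nonneg) simp
  have "s powr (1 / p) = 1" using f_norm by (simp add: lq_norm_def s_def)
  \<comment> \<open>Raising the norm to the power p removes the root, so its normalisation becomes
    total mass 1.\<close>
  moreover have "(s powr (1 / p)) powr p = s"
    using p_pos \<open>s \<ge> 0\<close> by (simp add: powr_powr)
  ultimately have "s = 1" by simp
  moreover have "s = (\<Sum>\<^sub>\<infinity>z\<in>int_lattice n. \<mu> z)"
    unfolding s_def \<mu>_def by (rule infsum_cong) (simp add: f_nonneg)
  moreover have "(\<Sum>\<^sub>\<infinity>z\<in>int_lattice n. \<mu> z) = sum \<mu> (Pi\<^sub>E {1..n} K)"
    by (rule infsum_lattice) (simp add: \<mu>_def)
  ultimately show "sum \<mu> (Pi\<^sub>E {1..n} K) = 1" by simp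
qed (auto simp: finite_proj \<mu>_def)

lemma supp_nonempty: "supp \<noteq> {}"
proof
  assume "supp = {}"
  then have "\<mu> z = 0" if "z \<in> box" for z
    using that box_subset by (auto simp: supp_def \<mu>_def)
  then show False using sum_one by simp
qed

lemma infsum_entropy: "(\<Sum>\<^sub>\<infinity>z\<in>int_lattice n. f z powr p * ln (f z powr p)) = neg_entropy {1..n}"
  unfolding neg_entropy_full \<mu>_def by (rule infsum_lattice) auto

text \<open>On the support ln \<mu> = p ln f, and elsewhere the weight is 0.\<close>

lemma sum_ln_f: "(\<Sum>z\<in>box. \<mu> z * ln (f z)) = neg_entropy {1..n} / p"
proof -
  have "\<mu> z * ln (f z) = \<mu> z * ln (\<mu> z) / p" for z
    using p_pos by (cases "f z = 0") (simp_all add: \<mu>_def ln_powr)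
  then show ?thesis by (simp add: neg_entropy_full sum_divide_distrib)
qed

lemma fun_upd_lattice:
  assumes "i \<in> {1..n}" "a \<in> Pi\<^sub>E ({1..n} - {i}) (\<lambda>_. UNIV)"
  shows "a(i := t) \<in> int_lattice n"
  using assms by (auto simp: int_lattice_def PiE_iff extensional_def)

section \<open>Fibre maxima and the norms of the functions f_i\<close>

context
  fixes i :: nat
  assumes i: "i \<in> {1..n}"
begin

text \<open>Guarantees that \<open>Max\<close> in \<open>fibre_max\<close> is attained: on the
  lattice \<open>f\<close> takes only the value 0 and its values on the finite support.\<close>

lemma finite_fibre_values:
  assumes "a \<in> Pi\<^sub>E ({1..n} - {i}) (\<lambda>_. UNIV)"
  shows "finite (range (\<lambda>t. f (a(i := t))))"
proof (rule finite_subset)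
  show "range (\<lambda>t. f (a(i := t))) \<subseteq> insert 0 (f ` supp)"
    using fun_upd_lattice[OF i assms] by (auto simp: supp_def)
qed (simp add: finite_supp)

lemma fibre_max_ge:
  assumes "a \<in> Pi\<^sub>E ({1..n} - {i}) (\<lambda>_. UNIV)"
  shows "f (a(i := t)) \<le> fibre_max i f a"
  unfolding fibre_max_def using finite_fibre_values[OF assms] by (intro Max_ge) auto

lemma fibre_max_nonneg:
  assumes "a \<in> Pi\<^sub>E ({1..n} - {i}) (\<lambda>_. UNIV)"
  shows "fibre_max i f a \<ge> 0"
  using fibre_max_ge[OF assms] f_nonneg[OF fun_upd_lattice[OF i assms]] by (rule order_trans[rotated])

lemma fibre_max_eq_0:
  assumes "a \<in> Pi\<^sub>E ({1..n} - {i}) (\<lambda>_. UNIV)" "a \<notin> Pi\<^sub>E ({1..n} - {i}) K"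
  shows "fibre_max i f a = 0"
proof -
  have "f (a(i := t)) = 0" for t
  proof (rule f_eq_0[OF fun_upd_lattice[OF i assms(1)]])
    show "a(i := t) \<notin> box"
    proof
      assume "a(i := t) \<in> box"
      then have "a j \<in> K j" if "j \<in> {1..n} - {i}" for j
        using PiE_mem[of "a(i := t)" "{1..n}" K j] that by simp
      then show False using assms by (auto simp: PiE_iff)
    qed
  qed
  then show ?thesis by (simp add: fibre_max_def)
qed

text \<open>The norm is carried over by the bijection \<open>insert_coord\<close>, and then cut down
  to the finite box, off which every fibre maximum is 0.\<close>

lemma lq_norm_coord_max:
  "lq_norm (n - 1) 1 (coord_max i f) = sum (fibre_max i f) (Pi\<^sub>E ({1..n} - {i}) K)"
proof -
  let ?P = "Pi\<^sub>E ({1..n} - {i}) (\<lambda>_. UNIV :: int set)"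
  have sub: "Pi\<^sub>E ({1..n} - {i}) K \<subseteq> ?P" by (rule PiE_mono) auto
  have "(\<Sum>\<^sub>\<infinity>z\<in>int_lattice (n - 1). \<bar>coord_max i f z\<bar> powr 1)
      = (\<Sum>\<^sub>\<infinity>z\<in>int_lattice (n - 1). \<bar>fibre_max i f (insert_coord i undefined z)\<bar>)"
    by (simp add: coord_max_eq_fibre_max)
  also have "\<dots> = (\<Sum>\<^sub>\<infinity>a\<in>?P. \<bar>fibre_max i f a\<bar>)"
    by (rule infsum_reindex_bij_betw[OF bij_betw_insert_coord[OF i]])
  also have "\<dots> = (\<Sum>\<^sub>\<infinity>a\<in>Pi\<^sub>E ({1..n} - {i}) K. fibre_max i f a)"
    by (rule infsum_cong_neutral) (use sub fibre_max_eq_0 fibre_max_nonneg in auto)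
  also have "\<dots> = sum (fibre_max i f) (Pi\<^sub>E ({1..n} - {i}) K)"
    by (simp add: finite_PiE finite_proj)
  finally have "lq_norm (n - 1) 1 (coord_max i f) = sum (fibre_max i f) (Pi\<^sub>E ({1..n} - {i}) K) powr 1"
    by (simp add: lq_norm_def)
  moreover have "sum (fibre_max i f) (Pi\<^sub>E ({1..n} - {i}) K) \<ge> 0"
    by (rule sum_nonneg) (use sub fibre_max_nonneg in auto)
  ultimately show ?thesis by simp
qed

text \<open>The fibre through a point of the support has a positive maximum.\<close>

lemma lq_norm_coord_max_pos: "lq_norm (n - 1) 1 (coord_max i f) > 0"
proof -
  have sub: "Pi\<^sub>E ({1..n} - {i}) K \<subseteq> Pi\<^sub>E ({1..n} - {i}) (\<lambda>_. UNIV)" by (rule PiE_mono) auto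
  obtain z where z: "z \<in> supp" using supp_nonempty by auto
  define a where "a = restrict z ({1..n} - {i})"
  have a: "a \<in> Pi\<^sub>E ({1..n} - {i}) K"
    using z by (auto simp: a_def K_def)
  have "a(i := z i) = z"
    using z i by (auto simp: a_def supp_def int_lattice_def PiE_iff extensional_def)
  then have "fibre_max i f a > 0"
    using fibre_max_ge[of a "z i"] a sub f_pos_iff[of z] z by (auto simp: supp_def)
  moreover have "finite (Pi\<^sub>E ({1..n} - {i}) K)" by (simp add: finite_PiE finite_proj)
  ultimately show ?thesis unfolding lq_norm_coord_max
    using a sub fibre_max_nonneg by (intro sum_pos2[where i = a]) blast+
qed

text \<open>This is \<open>fibre_bound_inequality\<close> with the fibre maximum as majorant, where
  \<open>sum_ln_f\<close> replaces the expectation of ln f by -H(X) / p.\<close>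

lemma ln_lq_norm_coord_max:
  shows "neg_entropy {1..n} / p - neg_entropy ({1..n} - {i}) \<le> ln (lq_norm (n - 1) 1 (coord_max i f))"
    and "neg_entropy {1..n} / p - neg_entropy ({1..n} - {i}) = ln (lq_norm (n - 1) 1 (coord_max i f)) \<Longrightarrow>
      z \<in> supp \<Longrightarrow> f z = lq_norm (n - 1) 1 (coord_max i f) * marginal ({1..n} - {i}) z"
proof -
  have sub: "Pi\<^sub>E ({1..n} - {i}) K \<subseteq> Pi\<^sub>E ({1..n} - {i}) (\<lambda>_. UNIV)" by (rule PiE_mono) auto
  have 1: "f z > 0" if "z \<in> box" "\<mu> z > 0" for z
    using that box_subset f_pos_iff \<mu>_pos_iff by blast
  have 2: "fibre_max i f a \<ge> 0" if "a \<in> Pi\<^sub>E ({1..n} - {i}) K" for a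
    using that sub fibre_max_nonneg by blast
  have 3: "0 \<le> f (a(i := b)) \<and> f (a(i := b)) \<le> fibre_max i f a" if "a \<in> Pi\<^sub>E ({1..n} - {i}) K" for a b
  proof -
    have a: "a \<in> Pi\<^sub>E ({1..n} - {i}) (\<lambda>_. UNIV)" using that sub by blast
    show ?thesis using fibre_max_ge[OF a] f_nonneg[OF fun_upd_lattice[OF i a]] by blast
  qed
  note bound = fibre_bound_inequality[where f = f and h = "fibre_max i f",
      OF i 1 2 3 lq_norm_coord_max[symmetric] lq_norm_coord_max_pos]
  show "neg_entropy {1..n} / p - neg_entropy ({1..n} - {i}) \<le> ln (lq_norm (n - 1) 1 (coord_max i f))"
    using bound(1) by (simp add: sum_ln_f)
  show "f z = lq_norm (n - 1) 1 (coord_max i f) * marginal ({1..n} - {i}) z"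
    if "neg_entropy {1..n} / p - neg_entropy ({1..n} - {i}) = ln (lq_norm (n - 1) 1 (coord_max i f))"
      "z \<in> supp"
    using bound(2)[of z] that supp_subset \<mu>_pos_iff[of z] by (auto simp: sum_ln_f supp_def)
qed

end

section \<open>The inequality and its equality cases\<close>

text \<open>The claim multiplied by n. Its left side is the sum of the n lower bounds for the ln of
  the norms, minus the nonnegative gap in Han's inequality. Equality therefore makes both Han's
  inequality and every single norm bound sharp.\<close>

lemma entropy_inequality:
  shows "(1 + real n / p - real n) * neg_entropy {1..n} \<le> (\<Sum>i=1..n. ln (lq_norm (n - 1) 1 (coord_max i f)))"
    and "(1 + real n / p - real n) * neg_entropy {1..n} = (\<Sum>i=1..n. ln (lq_norm (n - 1) 1 (coord_max i f))) \<Longrightarrow>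
      i \<in> {1..n} \<Longrightarrow> z \<in> box \<Longrightarrow> \<mu> z = marginal ({1..n} - {i}) z * marginal {i} z"
    and "(1 + real n / p - real n) * neg_entropy {1..n} = (\<Sum>i=1..n. ln (lq_norm (n - 1) 1 (coord_max i f))) \<Longrightarrow>
      i \<in> {1..n} \<Longrightarrow> z \<in> supp \<Longrightarrow> f z = lq_norm (n - 1) 1 (coord_max i f) * marginal ({1..n} - {i}) z"
proof -
  let ?E = "neg_entropy {1..n}"
  let ?H = "\<Sum>i=1..n. ?E - neg_entropy ({1..n} - {i})"
  let ?G = "\<lambda>i. ?E / p - neg_entropy ({1..n} - {i})"
  let ?N = "\<lambda>i. ln (lq_norm (n - 1) 1 (coord_max i f))"
  have split: "(1 + real n / p - real n) * ?E = sum ?G {1..n} - (?H - ?E)"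
    by (simp add: sum_subtractf algebra_simps)
  have han: "?E \<le> ?H" by (rule han_inequality)
  have le: "sum ?G {1..n} \<le> sum ?N {1..n}"
    by (rule sum_mono) (rule ln_lq_norm_coord_max(1))
  show "(1 + real n / p - real n) * ?E \<le> sum ?N {1..n}" using split han le by linarith
  assume eq: "(1 + real n / p - real n) * ?E = sum ?N {1..n}" and i: "i \<in> {1..n}"
  have "?E = ?H" "sum ?G {1..n} = sum ?N {1..n}" using split han le eq by linarith+
  then show "z \<in> box \<Longrightarrow> \<mu> z = marginal ({1..n} - {i}) z * marginal {i} z"
    using han_inequality(2) i by blast
  \<comment> \<open>Equal sums of termwise ordered families agree term by term.\<close>
  have "?G i = ?N i"
    using sum_mono_inv[OF \<open>sum ?G {1..n} = sum ?N {1..n}\<close>] ln_lq_norm_coord_max(1) i by auto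
  then show "z \<in> supp \<Longrightarrow> f z = lq_norm (n - 1) 1 (coord_max i f) * marginal ({1..n} - {i}) z"
    using ln_lq_norm_coord_max(2)[OF i] by blast
qed

text \<open>In the equality case replacing one coordinate of a point of the support by that of another
  stays in the support and preserves \<open>f\<close>; any two points of the box are joined by such moves.\<close>

lemma equality_imp_product:
  assumes eq: "(1 + real n / p - real n) * neg_entropy {1..n} = (\<Sum>i=1..n. ln (lq_norm (n - 1) 1 (coord_max i f)))"
  shows "supp = Pi\<^sub>E {1..n} K" and "z \<in> int_lattice n \<Longrightarrow> f z = real (card supp) powr (- (1 / p)) * indicator supp z"
proof -
  have move: "z(i := t) \<in> supp \<and> f (z(i := t)) = f z" if "z \<in> supp" "i \<in> {1..n}" and t: "t \<in> K i" for z i t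
  proof -
    obtain w where w: "w \<in> supp" "t = w i" using t by (auto simp: K_def)
    have z_pos: "\<mu> z > 0" and w_pos: "\<mu> w > 0"
      using that(1) w(1) \<mu>_pos_iff by (auto simp: supp_def)
    have z_box: "z \<in> box" and w_box: "w \<in> box" using that(1) w(1) supp_subset by auto
    have upd: "z(i := t) \<in> box"
      using z_box that by (auto simp: PiE_iff extensional_def)
    have m: "marginal ({1..n} - {i}) (z(i := t)) = marginal ({1..n} - {i}) z"
      by (simp add: marginal_fun_upd)
    \<comment> \<open>By independence \<mu> at the moved point is the product of a marginal seen at
      \<open>z\<close> and one seen at \<open>w\<close>, both positive.\<close>
    have "marginal {i} (z(i := t)) = marginal {i} w"
      by (rule marginal_cong) (simp add: w)
    then have "\<mu> (z(i := t)) > 0"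
      using entropy_inequality(2)[OF eq that(2) upd] m
        marginal_pos[OF z_box z_pos, of "{1..n} - {i}"] marginal_pos[OF w_box w_pos, of "{i}"] that(2)
      by simp
    then have "z(i := t) \<in> supp" using \<mu>_pos_iff upd box_subset by blast
    \<comment> \<open>On the support \<open>f\<close> is a constant times the marginal without
      coordinate i, which the move leaves unchanged.\<close>
    then show ?thesis
      using entropy_inequality(3)[OF eq that(2)] that(1) m by simp
  qed
  obtain z0 where z0: "z0 \<in> supp" using supp_nonempty by auto
  have const: "y \<in> supp \<and> f y = f z0" if y: "y \<in> box" for y
  proof -
    \<comment> \<open>The path from \<open>z0\<close> to \<open>y\<close>: the coordinates in
      \<open>J\<close> have already been replaced by those of \<open>y\<close>.\<close>
    have "override_on z0 y J \<in> supp \<and> f (override_on z0 y J) = f z0" if "J \<subseteq> {1..n}" for J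
    proof -
      have "finite J" using that finite_subset by blast
      then show ?thesis using that
      proof (induction J)
        case empty
        then show ?case by (simp add: z0)
      next
        case (insert i J)
        then have "y i \<in> K i" using y by (auto simp: PiE_iff)
        then have "(override_on z0 y J)(i := y i) \<in> supp \<and> f ((override_on z0 y J)(i := y i)) = f z0"
          using move[of "override_on z0 y J" i "y i"] insert by simp
        moreover have "override_on z0 y (insert i J) = (override_on z0 y J)(i := y i)"
          by (auto simp: override_on_def)
        ultimately show ?case by (simp only:)
      qed
    qed
    moreover have "override_on z0 y {1..n} = y"
      using y z0 by (auto simp: override_on_def supp_def int_lattice_def PiE_iff extensional_def)
    ultimately show ?thesis by (metis subset_refl)
  qed
  show supp: "supp = Pi\<^sub>E {1..n} K" using const supp_subset by blast
  have f0: "f z0 > 0" using f_pos_iff z0 by (auto simp: supp_def)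
  have "(\<Sum>z\<in>box. \<mu> z) = real (card supp) * f z0 powr p"
    using const supp by (simp add: \<mu>_def)
  \<comment> \<open>Total mass 1, spread evenly over the support, fixes the constant value of
    \<open>f\<close>.\<close>
  then have mass: "real (card supp) * f z0 powr p = 1"
    using sum_one by simp
  have card: "real (card supp) > 0"
    using finite_supp supp_nonempty by (simp add: card_gt_0_iff)
  have "f z0 = (f z0 powr p) powr (1 / p)"
    using f0 p_pos by (simp add: powr_powr)
  also have "f z0 powr p = real (card supp) powr (- 1)"
    using mass card by (simp add: powr_minus field_simps)
  also have "\<dots> powr (1 / p) = real (card supp) powr (- (1 / p))"
    by (simp only: powr_powr) simp
  finally have "f z0 = real (card supp) powr (- (1 / p))" .
  then show "f z = real (card supp) powr (- (1 / p)) * indicator supp z" if "z \<in> int_lattice n"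
    using const supp that by (auto simp: indicator_def supp_def)
qed

text \<open>A direct computation. The law is uniform on A, so H(X) = ln |A|. Every fibre maximum
  over the box without factor i is the constant c, so the norm of f_i is c |A| / |K_i|. The
  logarithms of the |K_i| add up to ln |A| because A is a box.\<close>

lemma product_imp_equality:
  assumes A: "A \<subseteq> int_lattice n" "A \<noteq> {}" "finite A" "A = (\<Pi>\<^sub>E i\<in>{1..n}. (\<lambda>z. z i) ` A)"
    and f: "\<And>z. z \<in> int_lattice n \<Longrightarrow> f z = real (card A) powr (- (1 / p)) * indicator A z"
  shows "(1 + real n / p - real n) * neg_entropy {1..n} = (\<Sum>i=1..n. ln (lq_norm (n - 1) 1 (coord_max i f)))"
proof -
  define c where "c = real (card A) powr (- (1 / p))"
  have card: "real (card A) > 0" using A by (simp add: card_gt_0_iff)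
  then have c: "c > 0" by (simp add: c_def)
  have ln_c: "ln c = - ln (real (card A)) / p" using card by (simp add: c_def ln_powr)
  have "supp = A" using A(1) f c by (auto simp: supp_def c_def indicator_def)
  then have K: "K i = (\<lambda>z. z i) ` A" for i by (simp add: K_def)
  then have "K = (\<lambda>i. (\<lambda>z. z i) ` A)" by (rule ext)
  then have box: "box = A" using A(4) by simp
  have mu: "\<mu> z = 1 / real (card A)" if "z \<in> A" for z
  proof -
    have "f z = real (card A) powr (- (1 / p))" using f[of z] that A(1) by auto
    then have "\<mu> z = real (card A) powr (- (1 / p) * p)" by (simp only: \<mu>_def powr_powr)
    also have "- (1 / p) * p = - 1" using p_pos by simp
    finally show ?thesis using card by (simp add: powr_minus divide_inverse)
  qed
  have E: "neg_entropy {1..n} = - ln (real (card A))"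
    unfolding neg_entropy_full box using card by (simp add: mu ln_div)
  have K_pos: "card (K i) > 0" for i
    using A by (auto simp: K card_gt_0_iff)
  have "real (card A) = (\<Prod>i=1..n. real (card (K i)))"
    using card_PiE[of "{1..n}" K] box by simp
  then have sum_K: "(\<Sum>i=1..n. ln (real (card (K i)))) = ln (real (card A))"
    using K_pos by (simp add: ln_prod)
  have "ln (lq_norm (n - 1) 1 (coord_max i f))
      = ln c + ln (real (card A)) - ln (real (card (K i)))" if i: "i \<in> {1..n}" for i
  proof -
    let ?P = "Pi\<^sub>E ({1..n} - {i}) K"
    have max: "fibre_max i f a = c" if a: "a \<in> ?P" for a
    proof -
      have a': "a \<in> Pi\<^sub>E ({1..n} - {i}) (\<lambda>_. UNIV)" using a by (auto simp: PiE_iff)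
      obtain b where b: "b \<in> K i" using K_pos[of i] by (auto simp: card_gt_0_iff)
      \<comment> \<open>Here the product form of A is used: every fibre over the smaller box meets
        A, so the value c is attained.\<close>
      have "a(i := b) \<in> A"
        unfolding box[symmetric] using a b i by (auto simp: PiE_iff extensional_def)
      then have "c = f (a(i := b))"
        using f A(1) by (auto simp: c_def)
      then have "c \<in> range (\<lambda>t. f (a(i := t)))" by auto
      moreover have "f (a(i := t)) \<le> c" for t
        using f[OF fun_upd_lattice[OF i a']] c by (simp add: c_def indicator_def)
      ultimately show ?thesis
        unfolding fibre_max_def by (intro Max_eqI finite_fibre_values[OF i a']) auto
    qed
    have "card A = card (K i) * card ?P"
      unfolding box[symmetric] using i by (simp add: card_PiE prod.remove)
    then have "real (card ?P) = real (card A) / real (card (K i))"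
      using K_pos[of i] by simp
    moreover have "lq_norm (n - 1) 1 (coord_max i f) = c * real (card ?P)"
      by (simp add: lq_norm_coord_max[OF i] max)
    ultimately show ?thesis
      using c card K_pos[of i] by (simp add: ln_mult ln_div)
  qed
  then have "(\<Sum>i=1..n. ln (lq_norm (n - 1) 1 (coord_max i f)))
      = real n * (ln c + ln (real (card A))) - ln (real (card A))"
    by (simp add: sum_subtractf sum_K)
  then show ?thesis
    using p_pos by (simp add: E ln_c field_simps)
qed

end

theorem corollary1p4:
  fixes n :: nat and p :: real and f :: "(nat \<Rightarrow> int) \<Rightarrow> real"
  assumes "n \<ge> 2" and "p > 0"
    and "f \<in> C0 n"
    and "\<forall>z\<in>int_lattice n. f z \<ge> 0"
    and "lq_norm n p f = 1"
  shows "(1 / real n + 1 / p - 1) * (\<Sum>\<^sub>\<infinity>z\<in>int_lattice n. f z powr p * ln (f z powr p))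
           \<le> 1 / real n * (\<Sum>i=1..n. ln (lq_norm (n - 1) 1 (coord_max i f)))
       \<and> ((1 / real n + 1 / p - 1) * (\<Sum>\<^sub>\<infinity>z\<in>int_lattice n. f z powr p * ln (f z powr p))
             = 1 / real n * (\<Sum>i=1..n. ln (lq_norm (n - 1) 1 (coord_max i f)))
          \<longleftrightarrow> (\<exists>A. A \<subseteq> int_lattice n \<and> A \<noteq> {} \<and> finite A
                 \<and> A = (\<Pi>\<^sub>E i\<in>{1..n}. (\<lambda>z. z i) ` A)
                 \<and> (\<forall>z\<in>int_lattice n. f z = real (card A) powr (- (1 / p)) * indicator A z)))"
proof -
  interpret lattice_density n p f
    by unfold_locales (use assms in auto)
  define E where "E = neg_entropy {1..n}"
  define N where "N = (\<Sum>i=1..n. ln (lq_norm (n - 1) 1 (coord_max i f)))"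
  have n: "real n > 0" using assms(1) by simp
  \<comment> \<open>The lemmas above carry the factor n; dividing by n > 0 preserves the inequality
    and its equality case.\<close>
  have scale: "(1 / real n + 1 / p - 1) * E = 1 / real n * ((1 + real n / p - real n) * E)"
    using n assms(2) by (simp add: field_simps)
  have le: "(1 / real n + 1 / p - 1) * E \<le> 1 / real n * N"
    unfolding scale using entropy_inequality(1) n
    by (intro mult_left_mono) (simp_all add: E_def N_def)
  have eq_iff: "(1 / real n + 1 / p - 1) * E = 1 / real n * N \<longleftrightarrow> (1 + real n / p - real n) * E = N"
    unfolding scale using n by simp
  have iff: "(1 + real n / p - real n) * E = N \<longleftrightarrow>
      (\<exists>A. A \<subseteq> int_lattice n \<and> A \<noteq> {} \<and> finite A \<and> A = (\<Pi>\<^sub>E i\<in>{1..n}. (\<lambda>z. z i) ` A)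
        \<and> (\<forall>z\<in>int_lattice n. f z = real (card A) powr (- (1 / p)) * indicator A z))"
    (is "_ \<longleftrightarrow> (\<exists>A. ?Q A)")
  proof
    assume "(1 + real n / p - real n) * E = N"
    note product = equality_imp_product[OF this[unfolded E_def N_def]]
    have "supp = (\<Pi>\<^sub>E i\<in>{1..n}. (\<lambda>z. z i) ` supp)"
      using product(1) by (simp add: K_def[abs_def])
    moreover have "supp \<subseteq> int_lattice n" by (auto simp: supp_def)
    ultimately have "?Q supp"
      using product(2) supp_nonempty finite_supp by blast
    then show "\<exists>A. ?Q A" by blast
  next
    assume "\<exists>A. ?Q A"
    then show "(1 + real n / p - real n) * E = N"
      unfolding E_def N_def using product_imp_equality by blast
  qed
  show ?thesis
    unfolding infsum_entropy using le eq_iff iff by (simp add: E_def N_def)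
qed

end
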